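(* Let $G$ be a finite connected undirected weighted graph with $N$ vertices and Laplacian $\mathcal{L}$, whose largest eigenvalue is $\lambda_{N-1}$. Let $g$ be an SGWT kernel which is $K+1$ times continuously differentiable and satisfies $g(0)=0$, $g^{(r)}(0)=0$ for all $r<K$, and $g^{(K)}(0)=C\neq 0$. Assume that there are $t'>0$ and $B$ such that $|g^{(K+1)}(\lambda)|\le B$ for all $\lambda\in[0,t'\lambda_{N-1}]$. Let $m$ and $n$ be vertices of $G$ such that $d_G(m,n)>K$. Then there exist constants $D$ and $t''>0$ such that $$\frac{\psi_{t,n}(m)}{\|\psi_{t,n}\|}\le D\,t$$ for all $0<t<\min(t',t'')$.
   Context: A finite weighted undirected graph $G$ on vertices $1,\dots,N$ is given by a symmetric matrix $A=(a_{m,n})$ with non-negative entries, $a_{m,n}>0$ being the weight of the edge connecting $m$ and $n$ and $a_{m,n}=0$ if there is no such edge (loops are allowed). The degree of $m$ is $d(m)=\sum_n a_{m,n}$, $D$ is the diagonal matrix of degrees, and the (non-normalized) graph Laplacian is $\mathcal{L}=D-A$ (this degree matrix is unrelated to the constant $D$ in the claim). Since $\mathcal{L}$ is real symmetric and positive semidefinite and $G$ is connected, fix an orthonormal basis of eigenvectors $\chi_0,\dots,\chi_{N-1}$ of $\mathbb{R}^N$ with $\mathcal{L}\chi_\ell=\lambda_\ell\chi_\ell$ and $0=\lambda_0<\lambda_1\le\dots\le\lambda_{N-1}$. $d_G(m,n)$ is the shortest-path distance: the minimum number of edges in a path connecting $m$ and $n$ (edge weights are disregarded, only edges with positive weight count).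 An SGWT kernel is a function $g:[0,\infty)\to[0,\infty)$ with $g(0)=0$ and $\lim_{x\to\infty}g(x)=0$; derivatives at $0$ are one-sided. $K\ge 1$ is an integer. For $t>0$, $\psi_{t,n}=g(t\mathcal{L})\delta_n$ is the wavelet at scale $t$ centered at vertex $n$ (with $\delta_n$ the indicator vector of $n$), i.e. $\psi_{t,n}(m)=\sum_{\ell=0}^{N-1}g(t\lambda_\ell)\chi_\ell^*(n)\chi_\ell(m)$. $\|\cdot\|$ is the Euclidean norm on $\mathbb{R}^N$. *)

theory Defs
  imports "HOL-Analysis.Analysis"
begin

text \<open>The \<open>N\<close> vertices are the elements of a finite type \<open>'v\<close>, so \<open>N = CARD('v)\<close>, and a graph is
  given by its weighted adjacency matrix. The matrix is not required to have zero diagonal: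
  loops are allowed.\<close>

definition weighted_graph :: "real^'v^'v \<Rightarrow> bool" where
  "weighted_graph A \<longleftrightarrow> transpose A = A \<and> (\<forall>i j. 0 \<le> A $ i $ j)"

definition vdegree :: "real^'v^'v \<Rightarrow> 'v \<Rightarrow> real" where
  "vdegree A m = (\<Sum>n\<in>UNIV. A $ m $ n)"

definition degree_matrix :: "real^'v^'v \<Rightarrow> real^'v^'v" where
  "degree_matrix A = (\<chi> i j. if i = j then vdegree A i else 0)"

definition laplacian :: "real^'v^'v \<Rightarrow> real^'v^'v" where
  "laplacian A = degree_matrix A - A"

text \<open>A path is given by its list of vertices; it has one edge fewer than vertices. Vertices may
  repeat, which affects neither connectedness nor the minimal number of edges.\<close>

definition graph_path :: "real^'v^'v \<Rightarrow> 'v \<Rightarrow> 'v \<Rightarrow> 'v list \<Rightarrow> bool" where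
  "graph_path A m n p \<longleftrightarrow>
     p \<noteq> [] \<and> hd p = m \<and> last p = n \<and> successively (\<lambda>i j. A $ i $ j > 0) p"

definition connected_graph :: "real^'v^'v \<Rightarrow> bool" where
  "connected_graph A \<longleftrightarrow> (\<forall>m n. \<exists>p. graph_path A m n p)"

definition graph_dist :: "real^'v^'v \<Rightarrow> 'v \<Rightarrow> 'v \<Rightarrow> nat" where
  "graph_dist A m n = (LEAST k. \<exists>p. graph_path A m n p \<and> length p = Suc k)"

text \<open>The vectors \<open>e 0, \<dots>, e (N - 1)\<close> are an orthonormal eigenbasis of the Laplacian with
  eigenvalues \<open>0 = lam 0 < lam 1 \<le> \<dots> \<le> lam (N - 1)\<close>. Values of \<open>e\<close> and \<open>lam\<close> at indices
  \<open>\<ge> N\<close> are irrelevant. That the vectors span follows from there being \<open>N\<close> of them.\<close>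

definition laplacian_eigenbasis ::
    "real^'v^'v \<Rightarrow> (nat \<Rightarrow> real^'v) \<Rightarrow> (nat \<Rightarrow> real) \<Rightarrow> bool" where
  "laplacian_eigenbasis A e lam \<longleftrightarrow>
     (\<forall>i<CARD('v). \<forall>j<CARD('v). e i \<bullet> e j = (if i = j then 1 else 0)) \<and>
     (\<forall>l<CARD('v). laplacian A *v e l = lam l *\<^sub>R e l) \<and>
     lam 0 = 0 \<and>
     (1 < CARD('v) \<longrightarrow> 0 < lam 1) \<and>
     (\<forall>i j. i \<le> j \<and> j < CARD('v) \<longrightarrow> lam i \<le> lam j)"

text \<open>Functions on \<open>[0,\<infinity>)\<close> are represented by total functions of which only the values on
  \<open>{0..}\<close> are used.\<close>

definition sgwt_kernel :: "(real \<Rightarrow> real) \<Rightarrow> bool" where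
  "sgwt_kernel g \<longleftrightarrow> (\<forall>x\<ge>0. 0 \<le> g x) \<and> g 0 = 0 \<and> (g \<longlongrightarrow> 0) at_top"

text \<open>The \<open>r\<close>-th derivative on \<open>[0,\<infinity>)\<close>: one-sided at \<open>0\<close>, two-sided at positive points.\<close>

primrec halfline_deriv :: "nat \<Rightarrow> (real \<Rightarrow> real) \<Rightarrow> real \<Rightarrow> real" where
  "halfline_deriv 0 g = g"
| "halfline_deriv (Suc r) g =
     (\<lambda>x. vector_derivative (halfline_deriv r g) (at x within {0..}))"

definition halfline_C :: "nat \<Rightarrow> (real \<Rightarrow> real) \<Rightarrow> bool" where
  "halfline_C k g \<longleftrightarrow>
     (\<forall>r<k. halfline_deriv r g differentiable_on {0..}) \<and>
     continuous_on {0..} (halfline_deriv k g)"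

text \<open>The wavelet \<open>g(t L) \<delta>\<^sub>n\<close>, expanded in the eigenbasis. The eigenvectors are real, so the complex
  conjugation in the usual formula disappears.\<close>

definition wavelet ::
    "(real \<Rightarrow> real) \<Rightarrow> (nat \<Rightarrow> real^'v) \<Rightarrow> (nat \<Rightarrow> real) \<Rightarrow> real \<Rightarrow> 'v \<Rightarrow> real^'v" where
  "wavelet g e lam t n =
     (\<chi> m. \<Sum>l<CARD('v). g (t * lam l) * e l $ n * e l $ m)"

end

theory Submission
  imports Defs
begin

text \<open>The value of the wavelet at a distant vertex is of higher order in \<open>t\<close> than its norm.

  Taylor's formula at \<open>0\<close> gives \<open>g x = C x\<^sup>K / K! + O(x\<^bsup>K+1\<^esup>)\<close>, uniformly on
  \<open>[0, t' \<lambda>\<^bsub>N-1\<^esub>]\<close>, which contains every \<open>t \<lambda>\<^sub>l\<close> with \<open>t < t'\<close>.  Inserted in the eigenvector expansion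
  of \<open>\<psi>\<^bsub>t,n\<^esub>(m)\<close>, the leading term is a multiple of \<open>\<Sum>\<^sub>l \<lambda>\<^sub>l\<^sup>K \<chi>\<^sub>l(n) \<chi>\<^sub>l(m)\<close>, the \<open>(m,n)\<close> entry of
  the \<open>K\<close>-th power of the Laplacian.  The Laplacian only couples adjacent vertices, so this entry
  vanishes when the distance exceeds \<open>K\<close> (\<open>spectral_moment_eq_0\<close>); only the remainder is left and
  \<open>\<psi>\<^bsub>t,n\<^esub>(m) = O(t\<^bsup>K+1\<^esup>)\<close> (\<open>wavelet_upper_bound\<close>).

  In the other direction, \<open>\<delta>\<^sub>n\<close> is not a multiple of the constant eigenvector, because the graph has
  a second vertex; hence it has a non-zero component along some \<open>\<chi>\<^sub>l\<close> with \<open>\<lambda>\<^sub>l > 0\<close>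
  (\<open>ex_positive_mode\<close>).  The component of the wavelet along this \<open>\<chi>\<^sub>l\<close> is \<open>g (t \<lambda>\<^sub>l) \<chi>\<^sub>l(n)\<close>, which is of
  exact order \<open>t\<^sup>K\<close>, and it bounds the norm from below (\<open>wavelet_norm_lower_bound\<close>).  Dividing the
  two bounds leaves a factor \<open>t\<close>.\<close>

section \<open>Distance and the Laplacian\<close>

lemma graph_dist_le:
  assumes "graph_path A m n p" "length p = Suc k"
  shows "graph_dist A m n \<le> k"
  unfolding graph_dist_def using assms by (intro Least_le) blast

lemma graph_dist_self: "graph_dist A n n = 0"
  using graph_dist_le[of A n n "[n]" 0] by (simp add: graph_path_def)

lemma ex_shortest_path:
  assumes "connected_graph A"
  shows "\<exists>p. graph_path A m n p \<and> length p = Suc (graph_dist A m n)"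
proof -
  obtain p where p: "graph_path A m n p"
    using assms unfolding connected_graph_def by blast
  then have "length p = Suc (length p - 1)"
    by (cases p) (auto simp: graph_path_def)
  with p have "\<exists>k p. graph_path A m n p \<and> length p = Suc k" by blast
  then show ?thesis unfolding graph_dist_def by (rule LeastI_ex)
qed

lemma graph_dist_step:
  assumes "connected_graph A" "A $ m $ j > 0"
  shows "graph_dist A m n \<le> Suc (graph_dist A j n)"
proof -
  obtain p where p: "graph_path A j n p" "length p = Suc (graph_dist A j n)"
    using ex_shortest_path[OF assms(1)] by blast
  have "graph_path A m n (m # p)"
    using p(1) assms(2) by (cases p) (auto simp: graph_path_def)
  then show ?thesis using graph_dist_le p(2) by fastforce
qed

lemma laplacian_off_diagonal:
  assumes "m \<noteq> j"
  shows "laplacian A $ m $ j = - A $ m $ j"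
  using assms by (simp add: laplacian_def degree_matrix_def)

text \<open>By symmetry, column sums are row sums; these vanish because the diagonal holds the degrees.\<close>

lemma laplacian_column_sum:
  fixes A :: "real^'v^'v"
  assumes "weighted_graph A"
  shows "(\<Sum>i\<in>UNIV. laplacian A $ i $ j) = 0"
proof -
  have "A $ i $ j = A $ j $ i" for i
    using assms unfolding weighted_graph_def transpose_def
    by (metis vec_lambda_beta)
  then show ?thesis
    by (simp add: laplacian_def degree_matrix_def vdegree_def sum_subtractf)
qed

section \<open>The eigenbasis\<close>

lemma eigenbasis_inner:
  fixes A :: "real^'v^'v"
  assumes "laplacian_eigenbasis A e lam" "i < CARD('v)" "j < CARD('v)"
  shows "e i \<bullet> e j = (if i = j then 1 else 0)"
  using assms unfolding laplacian_eigenbasis_def by blast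

lemma eigenbasis_eigenvector:
  fixes A :: "real^'v^'v"
  assumes "laplacian_eigenbasis A e lam" "l < CARD('v)"
  shows "(\<Sum>j\<in>UNIV. laplacian A $ i $ j * e l $ j) = lam l * e l $ i"
proof -
  have "(laplacian A *v e l) $ i = (lam l *\<^sub>R e l) $ i"
    using assms unfolding laplacian_eigenbasis_def by simp
  then show ?thesis by (simp add: matrix_vector_mult_def)
qed

lemma eigenbasis_eigenvalue_pos:
  fixes A :: "real^'v^'v"
  assumes "laplacian_eigenbasis A e lam" "0 < l" "l < CARD('v)"
  shows "0 < lam l"
proof -
  have "0 < lam 1" "lam 1 \<le> lam l"
    using assms unfolding laplacian_eigenbasis_def by auto
  then show ?thesis by simp
qed

lemma eigenbasis_eigenvalue_bounds:
  fixes A :: "real^'v^'v"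
  assumes "laplacian_eigenbasis A e lam" "l < CARD('v)"
  shows "0 \<le> lam l" "lam l \<le> lam (CARD('v) - 1)"
proof -
  have "lam 0 = 0" "\<And>i j. i \<le> j \<Longrightarrow> j < CARD('v) \<Longrightarrow> lam i \<le> lam j"
    using assms unfolding laplacian_eigenbasis_def by auto
  from this(1) this(2)[of 0 l] this(2)[of l "CARD('v) - 1"]
  show "0 \<le> lam l" "lam l \<le> lam (CARD('v) - 1)" using assms(2) by auto
qed

text \<open>Orthonormality says that the square matrix with rows \<open>e l\<close> has its transpose as a right
  inverse; a right inverse of a square matrix is a left inverse, which is completeness.\<close>

lemma eigenbasis_complete:
  fixes A :: "real^'v^'v"
  assumes "laplacian_eigenbasis A e lam"
  shows "(\<Sum>l<CARD('v). e l $ n * e l $ m) = (if m = n then 1 else 0)"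
proof -
  obtain h :: "'v \<Rightarrow> nat" where h: "bij_betw h UNIV {..<CARD('v)}"
    using ex_bij_betw_finite_nat[of "UNIV :: 'v set"] by (auto simp: atLeast0LessThan)
  define Q :: "real^'v^'v" where "Q = (\<chi> i. e (h i))"
  have lt: "h i < CARD('v)" for i using h by (auto simp: bij_betw_def)
  have inj: "h i = h j \<longleftrightarrow> i = j" for i j using h by (auto simp: bij_betw_def inj_on_def)
  have "e (h i) \<bullet> e (h j) = (if i = j then 1 else 0)" for i j
    using eigenbasis_inner[OF assms lt lt] by (simp add: inj)
  then have "Q ** transpose Q = mat 1"
    by (simp add: vec_eq_iff matrix_matrix_mult_def transpose_def mat_def Q_def inner_vec_def)
  then have "transpose Q ** Q = mat 1" using matrix_left_right_inverse by blast
  then have "(transpose Q ** Q) $ m $ n = (mat 1 :: real^'v^'v) $ m $ n" by simp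
  then have "(\<Sum>i\<in>UNIV. e (h i) $ n * e (h i) $ m) = (if m = n then 1 else 0)"
    by (simp add: matrix_matrix_mult_def transpose_def mat_def Q_def mult.commute)
  then show ?thesis
    using sum.reindex_bij_betw[OF h, of "\<lambda>l. e l $ n * e l $ m"] by simp
qed

text \<open>The sum is the \<open>(m,n)\<close> entry of the \<open>k\<close>-th power of the Laplacian.  One more power applies
  the Laplacian to the vertex variable \<open>m\<close>, which mixes in only \<open>m\<close> itself and its neighbours, all
  of them still at distance more than \<open>k\<close> from \<open>n\<close>.\<close>

lemma spectral_moment_eq_0:
  fixes A :: "real^'v^'v"
  assumes "weighted_graph A" "connected_graph A" "laplacian_eigenbasis A e lam"
    and "graph_dist A m n > k"
  shows "(\<Sum>l<CARD('v). lam l ^ k * e l $ n * e l $ m) = 0"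
  using assms(4)
proof (induction k arbitrary: m)
  case 0
  then have "m \<noteq> n" using graph_dist_self[of A n] by auto
  then show ?case using eigenbasis_complete[OF assms(3), of n m] by simp
next
  case (Suc k)
  have "(\<Sum>l<CARD('v). lam l ^ Suc k * e l $ n * e l $ m)
      = (\<Sum>l<CARD('v). lam l ^ k * e l $ n * (\<Sum>j\<in>UNIV. laplacian A $ m $ j * e l $ j))"
    by (rule sum.cong) (simp_all add: eigenbasis_eigenvector[OF assms(3)])
  also have "\<dots> = (\<Sum>l<CARD('v). \<Sum>j\<in>UNIV. laplacian A $ m $ j * (lam l ^ k * e l $ n * e l $ j))"
    by (simp add: sum_distrib_left mult_ac)
  also have "\<dots> = (\<Sum>j\<in>UNIV. laplacian A $ m $ j * (\<Sum>l<CARD('v). lam l ^ k * e l $ n * e l $ j))"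
    unfolding sum_distrib_left by (rule sum.swap)
  also have "\<dots> = 0"
  proof (rule sum.neutral, rule ballI)
    fix j
    have "A $ m $ j \<ge> 0" using assms(1) unfolding weighted_graph_def by blast
    then consider "j = m" | "j \<noteq> m" "A $ m $ j = 0" | "A $ m $ j > 0"
      by force
    then show "laplacian A $ m $ j * (\<Sum>l<CARD('v). lam l ^ k * e l $ n * e l $ j) = 0"
    proof cases
      case 1
      then show ?thesis using Suc by simp
    next
      case 2
      then show ?thesis by (simp add: laplacian_off_diagonal)
    next
      case 3
      from graph_dist_step[OF assms(2) 3, of n] Suc.prems have "graph_dist A j n > k" by simp
      then show ?thesis using Suc.IH by simp
    qed
  qed
  finally show ?case .
qed

text \<open>Eigenvectors for positive eigenvalues are orthogonal to the constant vector \<open>1\<close>, so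
  completeness writes \<open>1\<close> as a multiple of \<open>e 0\<close>.  If \<open>\<delta>\<^sub>n\<close> had no component along the other
  eigenvectors, it would be a multiple of \<open>e 0\<close> as well, hence of \<open>1\<close>, which a second vertex
  forbids.\<close>

lemma ex_positive_mode:
  fixes A :: "real^'v^'v"
  assumes "weighted_graph A" "laplacian_eigenbasis A e lam" "m \<noteq> n"
  shows "\<exists>l<CARD('v). 0 < lam l \<and> e l $ n \<noteq> 0"
proof (rule ccontr)
  assume "\<not> ?thesis"
  then have zero: "e l $ n = 0" if "0 < l" "l < CARD('v)" for l
    using that eigenbasis_eigenvalue_pos[OF assms(2)] by blast
  have only0: "(\<Sum>l<CARD('v). f l) = f 0" if "\<And>l. 0 < l \<Longrightarrow> l < CARD('v) \<Longrightarrow> f l = 0"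
    for f :: "nat \<Rightarrow> real"
  proof -
    have "(\<Sum>l<CARD('v). f l) = (\<Sum>l\<in>{0}. f l)"
      by (rule sum.mono_neutral_right) (use that in auto)
    then show ?thesis by simp
  qed
  have "e 0 $ n * e 0 $ n = 1" "e 0 $ n * e 0 $ m = 0"
    using eigenbasis_complete[OF assms(2), of n n] eigenbasis_complete[OF assms(2), of n m]
      only0[of "\<lambda>l. e l $ n * e l $ n"] only0[of "\<lambda>l. e l $ n * e l $ m"] zero assms(3)
    by simp_all
  then have e0m: "e 0 $ m = 0" by auto
  have orth: "(\<Sum>k\<in>UNIV. e l $ k) = 0" if "0 < l" "l < CARD('v)" for l
  proof -
    have "lam l * (\<Sum>k\<in>UNIV. e l $ k) = (\<Sum>i\<in>UNIV. \<Sum>j\<in>UNIV. laplacian A $ i $ j * e l $ j)"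
      by (simp add: eigenbasis_eigenvector[OF assms(2) that(2)] sum_distrib_left)
    also have "\<dots> = (\<Sum>j\<in>UNIV. (\<Sum>i\<in>UNIV. laplacian A $ i $ j) * e l $ j)"
      unfolding sum_distrib_right by (rule sum.swap)
    also have "\<dots> = 0" by (simp add: laplacian_column_sum[OF assms(1)])
    finally show ?thesis using eigenbasis_eigenvalue_pos[OF assms(2) that] by simp
  qed
  have "(1::real) = (\<Sum>k\<in>UNIV. \<Sum>l<CARD('v). e l $ k * e l $ m)"
    by (simp add: eigenbasis_complete[OF assms(2)])
  also have "\<dots> = (\<Sum>l<CARD('v). (\<Sum>k\<in>UNIV. e l $ k) * e l $ m)"
    unfolding sum_distrib_right by (rule sum.swap)
  also have "\<dots> = (\<Sum>k\<in>UNIV. e 0 $ k) * e 0 $ m"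
    by (rule only0) (simp add: orth)
  finally show False using e0m by simp
qed

section \<open>The kernel near zero\<close>

lemma halfline_deriv_has_derivative:
  assumes "halfline_C k g" "r < k" "0 \<le> x"
  shows "(halfline_deriv r g has_real_derivative halfline_deriv (Suc r) g x) (at x within {0..})"
proof -
  have "halfline_deriv r g differentiable (at x within {0..})"
    using assms unfolding halfline_C_def differentiable_on_def by auto
  then show ?thesis
    by (simp add: vector_derivative_works has_real_derivative_iff_has_vector_derivative)
qed

text \<open>The derivatives at \<open>0\<close> are one-sided, so Taylor's formula has to be applied relative to
  the convex set \<open>{0..X}\<close>.  Its sum reduces to the term of order \<open>K\<close>.\<close>

lemma kernel_taylor_bound:
  assumes "halfline_C (K + 1) g" "\<forall>r<K. halfline_deriv r g 0 = 0"
    and bound: "\<forall>y\<in>{0..X}. \<bar>halfline_deriv (K + 1) g y\<bar> \<le> B"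
    and x: "x \<in> {0..X}"
  shows "\<bar>g x - halfline_deriv K g 0 / fact K * x ^ K\<bar> \<le> B / fact K * x ^ Suc K"
proof -
  have "norm (halfline_deriv 0 g x - (\<Sum>i\<le>K. halfline_deriv i g 0 * (x - 0) ^ i / fact i))
      \<le> B * norm (x - 0) ^ Suc K / fact K"
  proof (rule field_Taylor[where S = "{0..X}"])
    show "(halfline_deriv i g has_field_derivative halfline_deriv (Suc i) g y) (at y within {0..X})"
      if "y \<in> {0..X}" "i \<le> K" for i y
      by (rule has_field_derivative_subset[OF halfline_deriv_has_derivative[OF assms(1)]])
        (use that in auto)
  qed (use bound x in auto)
  moreover have "(\<Sum>i\<le>K. halfline_deriv i g 0 * (x - 0) ^ i / fact i)
      = (\<Sum>i\<in>{K}. halfline_deriv i g 0 * (x - 0) ^ i / fact i)"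
    by (rule sum.mono_neutral_right) (use assms(2) in auto)
  ultimately show ?thesis using x by simp
qed

section \<open>Bounds for the wavelet\<close>

text \<open>Subtracting the leading Taylor term from \<open>g\<close> does not change the value at \<open>m\<close>, since the
  \<open>K\<close>-th spectral moment vanishes there.\<close>

lemma wavelet_upper_bound:
  fixes A :: "real^'v^'v"
  assumes "weighted_graph A" "connected_graph A" "laplacian_eigenbasis A e lam"
    and "graph_dist A m n > K" and "0 \<le> t"
    and approx: "\<And>l. l < CARD('v) \<Longrightarrow>
      \<bar>g (t * lam l) - a * (t * lam l) ^ K\<bar> \<le> c * (t * lam l) ^ Suc K"
  shows "wavelet g e lam t n $ m
    \<le> c * (\<Sum>l<CARD('v). lam l ^ Suc K * \<bar>e l $ n * e l $ m\<bar>) * t ^ Suc K"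
proof -
  have moment: "(\<Sum>l<CARD('v). a * (t * lam l) ^ K * (e l $ n * e l $ m)) = 0"
  proof -
    have "(\<Sum>l<CARD('v). a * (t * lam l) ^ K * (e l $ n * e l $ m))
        = a * t ^ K * (\<Sum>l<CARD('v). lam l ^ K * e l $ n * e l $ m)"
      by (simp add: sum_distrib_left power_mult_distrib mult_ac)
    then show ?thesis using spectral_moment_eq_0[OF assms(1-4)] by simp
  qed
  have "wavelet g e lam t n $ m = (\<Sum>l<CARD('v). g (t * lam l) * (e l $ n * e l $ m))"
    by (simp add: wavelet_def mult.assoc)
  also have "\<dots> = (\<Sum>l<CARD('v). (g (t * lam l) - a * (t * lam l) ^ K) * (e l $ n * e l $ m))"
    by (simp add: left_diff_distrib sum_subtractf moment)
  also have "\<dots> \<le> (\<Sum>l<CARD('v). c * (t * lam l) ^ Suc K * \<bar>e l $ n * e l $ m\<bar>)"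
  proof (rule sum_mono)
    fix l assume "l \<in> {..<CARD('v)}"
    then have "\<bar>(g (t * lam l) - a * (t * lam l) ^ K) * (e l $ n * e l $ m)\<bar>
        \<le> c * (t * lam l) ^ Suc K * \<bar>e l $ n * e l $ m\<bar>"
      unfolding abs_mult[of "g (t * lam l) - a * (t * lam l) ^ K"]
      by (intro mult_right_mono approx) auto
    then show "(g (t * lam l) - a * (t * lam l) ^ K) * (e l $ n * e l $ m)
        \<le> c * (t * lam l) ^ Suc K * \<bar>e l $ n * e l $ m\<bar>"
      by (rule order_trans[OF abs_ge_self])
  qed
  also have "\<dots> = c * (\<Sum>l<CARD('v). lam l ^ Suc K * \<bar>e l $ n * e l $ m\<bar>) * t ^ Suc K"
    by (simp add: sum_distrib_left sum_distrib_right power_mult_distrib mult_ac)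
  finally show ?thesis .
qed

lemma wavelet_inner_eigenvector:
  fixes A :: "real^'v^'v"
  assumes "laplacian_eigenbasis A e lam" "l < CARD('v)"
  shows "wavelet g e lam t n \<bullet> e l = g (t * lam l) * e l $ n"
proof -
  have "wavelet g e lam t n = (\<Sum>k<CARD('v). (g (t * lam k) * e k $ n) *\<^sub>R e k)"
    by (simp add: vec_eq_iff wavelet_def)
  then have "wavelet g e lam t n \<bullet> e l
      = (\<Sum>k<CARD('v). (g (t * lam k) * e k $ n) * (e k \<bullet> e l))"
    by (simp add: inner_sum_left)
  also have "\<dots> = (\<Sum>k<CARD('v). if k = l then g (t * lam l) * e l $ n else 0)"
    by (rule sum.cong) (use assms eigenbasis_inner[OF assms(1)] in auto)
  finally show ?thesis using assms(2) by simp
qed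

text \<open>The norm is at least the modulus of any one coefficient in the orthonormal basis.\<close>

lemma wavelet_norm_lower_bound:
  fixes A :: "real^'v^'v"
  assumes "laplacian_eigenbasis A e lam" "l < CARD('v)"
  shows "\<bar>g (t * lam l)\<bar> * \<bar>e l $ n\<bar> \<le> norm (wavelet g e lam t n)"
proof -
  have "norm (e l) = 1"
    using eigenbasis_inner[OF assms(1,2,2)] by (simp add: norm_eq_1)
  then show ?thesis
    using Cauchy_Schwarz_ineq2[of "wavelet g e lam t n" "e l"]
    by (simp add: wavelet_inner_eigenvector[OF assms] abs_mult)
qed

lemma leading_term_dominates:
  fixes a c x :: real
  assumes "\<bar>y - a * x ^ K\<bar> \<le> c * x ^ Suc K" "0 \<le> x" "c * x \<le> \<bar>a\<bar> / 2"
  shows "\<bar>a\<bar> / 2 * x ^ K \<le> \<bar>y\<bar>"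
proof -
  have "c * x ^ Suc K \<le> \<bar>a\<bar> / 2 * x ^ K"
    using mult_right_mono[OF assms(3), of "x ^ K"] assms(2) by (simp add: mult_ac)
  moreover have "\<bar>a * x ^ K\<bar> = \<bar>a\<bar> * x ^ K" using assms(2) by (simp add: abs_mult)
  ultimately show ?thesis using assms(1) by linarith
qed

theorem theorem5p7:
  fixes A :: "real^'v^'v"
    and e :: "nat \<Rightarrow> real^'v"
    and lam :: "nat \<Rightarrow> real"
    and g :: "real \<Rightarrow> real"
    and K :: nat
    and C B t' :: real
    and m n :: 'v
  assumes "weighted_graph A"
    and "connected_graph A"
    and "laplacian_eigenbasis A e lam"
    and "K \<ge> 1"
    and "sgwt_kernel g"
    and "halfline_C (K + 1) g"
    and "\<forall>r<K. halfline_deriv r g 0 = 0"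
    and "halfline_deriv K g 0 = C" and "C \<noteq> 0"
    and "t' > 0"
    and "\<forall>x\<in>{0..t' * lam (CARD('v) - 1)}. \<bar>halfline_deriv (K + 1) g x\<bar> \<le> B"
    and "graph_dist A m n > K"
  shows "\<exists>D t''. t'' > 0 \<and>
    (\<forall>t. 0 < t \<and> t < min t' t'' \<longrightarrow>
       wavelet g e lam t n \<noteq> 0 \<and>
       wavelet g e lam t n $ m / norm (wavelet g e lam t n) \<le> D * t)"
proof -
  note eb = assms(3)
  have "m \<noteq> n" using assms(12) graph_dist_self[of A n] by auto
  then obtain l where l: "l < CARD('v)" "0 < lam l" "e l $ n \<noteq> 0"
    using ex_positive_mode[OF assms(1) eb] by blast
  define a where "a = C / fact K"
  define c where "c = B / fact K"
  define M where "M = c * (\<Sum>l<CARD('v). lam l ^ Suc K * \<bar>e l $ n * e l $ m\<bar>)"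
  define b where "b = \<bar>a\<bar> / 2 * lam l ^ K * \<bar>e l $ n\<bar>"
  have "a \<noteq> 0" using assms(9) by (simp add: a_def)
  then have b: "b > 0" using l by (simp add: b_def)
  have "0 \<le> t' * lam (CARD('v) - 1)"
    using assms(10) eigenbasis_eigenvalue_bounds(1)[OF eb, of "CARD('v) - 1"] by simp
  then have "\<bar>halfline_deriv (K + 1) g 0\<bar> \<le> B" using assms(11) by auto
  then have "B \<ge> 0" by linarith
  then have c: "c \<ge> 0" by (simp add: c_def)
  have M: "M \<ge> 0" unfolding M_def
    using c eigenbasis_eigenvalue_bounds(1)[OF eb] by (intro mult_nonneg_nonneg sum_nonneg) auto
  \<comment> \<open>For \<open>t < t''\<close> the Taylor remainder at \<open>t * lam l\<close> is at most half of the leading term, so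
    half of the leading term remains in \<open>b\<close>.  The summand \<open>1\<close> keeps the denominator positive when \<open>B = 0\<close>.\<close>
  define t'' where "t'' = \<bar>a\<bar> / 2 / (c * lam l + 1)"
  have den: "c * lam l + 1 > 0" using c l by (intro add_nonneg_pos) auto
  then have t'': "t'' > 0" using \<open>a \<noteq> 0\<close> by (simp add: t''_def)
  have "wavelet g e lam t n \<noteq> 0 \<and>
      wavelet g e lam t n $ m / norm (wavelet g e lam t n) \<le> M / b * t"
    if t: "0 < t" "t < min t' t''" for t
  proof -
    let ?w = "wavelet g e lam t n"
    have approx: "\<bar>g (t * lam k) - a * (t * lam k) ^ K\<bar> \<le> c * (t * lam k) ^ Suc K"
      if "k < CARD('v)" for k
    proof -
      have "t * lam k \<in> {0..t' * lam (CARD('v) - 1)}"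
        using eigenbasis_eigenvalue_bounds[OF eb that] t by (auto intro!: mult_mono)
      then show ?thesis
        using kernel_taylor_bound[OF assms(6,7,11)] assms(8) by (simp add: a_def c_def)
    qed
    have upper: "?w $ m \<le> M * t ^ Suc K"
      unfolding M_def using assms(1-3,12) t(1) approx
      by (intro wavelet_upper_bound[where a = a]) auto
    have "t < \<bar>a\<bar> / 2 / (c * lam l + 1)" using t(2) by (simp add: t''_def)
    then have "t * (c * lam l + 1) < \<bar>a\<bar> / 2" using den by (simp only: pos_less_divide_eq)
    then have "c * (t * lam l) \<le> \<bar>a\<bar> / 2" using t(1) unfolding distrib_left by (simp add: mult_ac)
    then have "\<bar>a\<bar> / 2 * (t * lam l) ^ K \<le> \<bar>g (t * lam l)\<bar>"
      using leading_term_dominates[OF approx[OF l(1)]] t(1) l(2) by simp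
    then have "\<bar>a\<bar> / 2 * (t * lam l) ^ K * \<bar>e l $ n\<bar> \<le> \<bar>g (t * lam l)\<bar> * \<bar>e l $ n\<bar>"
      by (rule mult_right_mono) simp
    also have "\<dots> \<le> norm ?w" by (rule wavelet_norm_lower_bound[OF eb l(1)])
    finally have lower: "b * t ^ K \<le> norm ?w"
      by (simp add: b_def power_mult_distrib mult_ac)
    have pos: "0 < b * t ^ K" using b t(1) by simp
    have "?w $ m / norm ?w \<le> M * t ^ Suc K / norm ?w"
      by (rule divide_right_mono[OF upper]) simp
    also have "\<dots> \<le> M * t ^ Suc K / (b * t ^ K)"
      by (rule divide_left_mono[OF lower]) (use M t(1) pos lower in \<open>auto intro!: mult_pos_pos\<close>)
    also have "\<dots> = M / b * t" using t(1) b by simp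
    finally show ?thesis using pos lower by auto
  qed
  then show ?thesis using t'' by blast
qed

end
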